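(* Let $A\colon\mathbb{R}^+\to M(n,\mathbb{R})$ be continuous with $\sup_{t\in\mathbb{R}^+}\|A(t)\|=M>0$. Suppose that there are constants $K\ge 1$ and $\alpha>0$ such that the transition matrix $\Phi(t,s)$ of $\dot x=A(t)x$ satisfies $\|\Phi(t,s)\|\le Ke^{-\alpha(t-s)}$ for all $t\ge s\ge 0$. Let $f\colon\mathbb{R}^+\times\mathbb{R}^n\to\mathbb{R}^n$ and suppose that there are constants $\gamma,\mu\geq 0$ such that $|f(t,y)-f(t,\bar y)|\le\gamma|y-\bar y|$ and $|f(t,y)|\le\mu$ for all $t\ge 0$ and $y,\bar y\in\mathbb{R}^n$. Assume that $\frac{K\gamma}{\alpha}<1$. If the system $\dot y=A(t)y+f(t,y)$ has an equilibrium, then it is unique.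
   Context: $\mathbb{R}^+=[0,+\infty)$; $M(n,\mathbb{R})$ is the space of real $n\times n$ matrices; $|\cdot|$ is a vector norm on $\mathbb{R}^n$ and $\|\cdot\|$ a matrix norm compatible with it ($|Bv|\le\|B\||v|$). The transition matrix $\Phi(t,s)$ is the solution of $\partial_t\Phi(t,s)=A(t)\Phi(t,s)$, $\Phi(s,s)=I$. A vector $\bar y\in\mathbb{R}^n$ is an equilibrium of $\dot y=A(t)y+f(t,y)$ if $A(t)\bar y+f(t,\bar y)=0$ for all $t\ge 0$. *)

theory Defs
  imports "HOL-Analysis.Analysis"
begin

text \<open>The norms in the statement are arbitrary, so they are functions satisfying the norm axioms
  rather than the fixed Euclidean norm of the type class.\<close>

definition is_norm :: "('a::real_vector \<Rightarrow> real) \<Rightarrow> bool" where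
  "is_norm N \<longleftrightarrow>
     (\<forall>x. 0 \<le> N x) \<and>
     (\<forall>x. N x = 0 \<longleftrightarrow> x = 0) \<and>
     (\<forall>c x. N (c *\<^sub>R x) = \<bar>c\<bar> * N x) \<and>
     (\<forall>x y. N (x + y) \<le> N x + N y)"

text \<open>A matrix norm is taken to be a norm on the vector space of matrices;
  submultiplicativity is not required.\<close>

definition compatible_norms ::
    "(real ^ 'n \<Rightarrow> real) \<Rightarrow> (real ^ 'n ^ 'n \<Rightarrow> real) \<Rightarrow> bool" where
  "compatible_norms vnorm mnorm \<longleftrightarrow>
     (\<forall>B v. vnorm (B *v v) \<le> mnorm B * vnorm v)"

text \<open>Time is restricted to \<open>[0, \<infinity>)\<close>; at \<open>t = 0\<close> the derivative is one-sided.\<close>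

definition is_transition_matrix ::
    "(real \<Rightarrow> real ^ 'n ^ 'n) \<Rightarrow> (real \<Rightarrow> real \<Rightarrow> real ^ 'n ^ 'n) \<Rightarrow> bool" where
  "is_transition_matrix A \<Phi> \<longleftrightarrow>
     (\<forall>s\<ge>0. \<Phi> s s = mat 1 \<and>
        (\<forall>t\<ge>0. ((\<lambda>t. \<Phi> t s) has_vector_derivative A t ** \<Phi> t s) (at t within {0..})))"

definition is_equilibrium ::
    "(real \<Rightarrow> real ^ 'n ^ 'n) \<Rightarrow> (real \<Rightarrow> real ^ 'n \<Rightarrow> real ^ 'n) \<Rightarrow> real ^ 'n \<Rightarrow> bool" where
  "is_equilibrium A f y \<longleftrightarrow> (\<forall>t\<ge>0. A t *v y + f t y = 0)"

end

theory Submission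
  imports Defs "HOL-Real_Asymp.Real_Asymp"
begin

text \<open>
  If \<open>y1\<close> and \<open>y2\<close> are equilibria and \<open>z = y2 - y1\<close>, then \<open>A(t) z = f(t, y1) - f(t, y2)\<close>, so
  \<open>|A(t) z| \<le> \<gamma> |z|\<close> for every \<open>t \<ge> 0\<close>: the linear flow moves \<open>z\<close> slowly.  On the other hand,
  exponential decay forces the flow to carry \<open>z\<close> all the way to \<open>0\<close>.  These two facts are
  incompatible with \<open>K \<gamma> < \<alpha>\<close> unless \<open>z = 0\<close>.

  The usual way to see this is variation of constants for the constant solution \<open>z\<close>,
  \<open>z = \<Phi>(t, 0) z - \<integral>\<^sub>0\<^sup>t \<Phi>(t, s) A(s) z ds\<close>, whose norm is at most
  \<open>K exp(-\<alpha> t) |z| + K \<gamma> / \<alpha> |z|\<close>.  The proof below uses a discrete form of the same identity, which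
  avoids differentiating \<open>\<Phi>(t, s)\<close> in \<open>s\<close>.  For a step \<open>h > 0\<close>, the cocycle identity gives
  \<open>\<Phi>(nh, 0) z - z = \<Sum>\<^sub>k \<Phi>(nh, (k + 1)h) (\<Phi>((k + 1)h, kh) z - z)\<close>.  Each bracket is at most
  \<open>h (\<gamma> + O(h)) |z|\<close> uniformly in \<open>k\<close> (\<open>one_step_displacement\<close>), and the decay of \<open>\<Phi>\<close> turns the sum
  into a geometric series with ratio \<open>exp(-\<alpha> h)\<close> (\<open>displacement_le_geometric_sum\<close>).  Letting
  \<open>n \<rightarrow> \<infinity>\<close> and then \<open>h \<rightarrow> 0\<close> yields \<open>|z| \<le> K \<gamma> / \<alpha> |z|\<close>.
\<close>

section \<open>Arbitrary norms on Euclidean space\<close>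

lemma is_norm_zero:
  assumes "is_norm N"
  shows "N 0 = 0"
  using assms unfolding is_norm_def by blast

lemma is_norm_minus_commute:
  assumes "is_norm N"
  shows "N (x - y) = N (y - x)"
proof -
  have "N ((-1) *\<^sub>R (x - y)) = \<bar>-1\<bar> * N (x - y)"
    using assms unfolding is_norm_def by blast
  then show ?thesis by simp
qed

lemma is_norm_triangle:
  assumes "is_norm N"
  shows "N (x + y) \<le> N x + N y"
  using assms unfolding is_norm_def by blast

lemma is_norm_convex_on:
  assumes "is_norm N"
  shows "convex_on UNIV N"
proof (rule convex_onI)
  fix t :: real and x y
  assume "0 < t" "t < 1"
  have "N ((1 - t) *\<^sub>R x + t *\<^sub>R y) \<le> N ((1 - t) *\<^sub>R x) + N (t *\<^sub>R y)"
    by (rule is_norm_triangle[OF assms])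
  also have "\<dots> = (1 - t) * N x + t * N y"
    using assms \<open>0 < t\<close> \<open>t < 1\<close> unfolding is_norm_def by simp
  finally show "N ((1 - t) *\<^sub>R x + t *\<^sub>R y) \<le> (1 - t) * N x + t * N y" .
qed simp

text \<open>The difference quotient of \<open>u\<close> lies in the closed convex ball \<open>{v. N v \<le> B}\<close>: otherwise a
  hyperplane separates it from the ball, which contradicts the scalar mean value theorem for
  \<open>u\<close> composed with the functional defining that hyperplane.\<close>

lemma is_norm_mean_value_inequality:
  fixes u :: "real \<Rightarrow> 'a::euclidean_space"
  assumes N: "is_norm N" and "a \<le> b"
    and der: "\<And>t. t \<in> {a..b} \<Longrightarrow> (u has_vector_derivative u' t) (at t within {a..b})"
    and bound: "\<And>t. t \<in> {a..b} \<Longrightarrow> N (u' t) \<le> B"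
  shows "N (u b - u a) \<le> (b - a) * B"
proof (cases "a = b")
  case True
  then show ?thesis by (simp add: is_norm_zero[OF N])
next
  case False
  with \<open>a \<le> b\<close> have "a < b" by simp
  define S where "S = {v. N v \<le> B}"
  define q where "q = (u b - u a) /\<^sub>R (b - a)"
  have "continuous_on UNIV N"
    by (rule convex_on_continuous[OF open_UNIV is_norm_convex_on[OF N]])
  then have "closed S" unfolding S_def
    by (intro closed_Collect_le) auto
  moreover have "convex S"
  proof (rule convexI)
    fix x y :: 'a and s t :: real
    assume "x \<in> S" "y \<in> S" and st: "0 \<le> s" "0 \<le> t" "s + t = 1"
    have "N (s *\<^sub>R x + t *\<^sub>R y) \<le> s * N x + t * N y"
      using is_norm_triangle[OF N, of "s *\<^sub>R x" "t *\<^sub>R y"] N st unfolding is_norm_def by simp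
    also have "\<dots> \<le> B"
      using \<open>x \<in> S\<close> \<open>y \<in> S\<close> st unfolding S_def by (intro convex_bound_le) auto
    finally show "s *\<^sub>R x + t *\<^sub>R y \<in> S" unfolding S_def by simp
  qed
  moreover have "\<exists>v\<in>S. inner w q = inner w v" for w
  proof -
    have "((\<lambda>t. inner w (u t)) has_derivative (\<lambda>h. h * inner w (u' t))) (at t within {a..b})"
      if "a \<le> t" "t \<le> b" for t
      using has_derivative_inner_right[OF der[unfolded has_vector_derivative_def], of t w] that
      by simp
    from mvt_simple[OF \<open>a < b\<close> this] obtain t where t: "t \<in> {a<..<b}"
      and eq: "inner w (u b) - inner w (u a) = (b - a) * inner w (u' t)"
      by blast
    have "inner w q = inner w (u' t)"
      using eq \<open>a < b\<close> unfolding q_def by (simp add: inner_diff_right)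
    moreover have "u' t \<in> S" unfolding S_def using bound[of t] t by simp
    ultimately show ?thesis by blast
  qed
  ultimately have "q \<in> S"
    using separating_hyperplane_closed_point[of S q] by (metis order.asym)
  have "u b - u a = (b - a) *\<^sub>R q" using \<open>a < b\<close> by (simp add: q_def)
  then have "N (u b - u a) = (b - a) * N q"
    using N \<open>a < b\<close> unfolding is_norm_def by simp
  also have "\<dots> \<le> (b - a) * B"
    using \<open>q \<in> S\<close> \<open>a < b\<close> unfolding S_def by (simp add: mult_left_mono)
  finally show ?thesis .
qed

section \<open>The transition matrix as an evolution family\<close>

text \<open>A Gronwall argument: on \<open>[s, T]\<close> the matrices \<open>A t\<close> have a common operator norm bound \<open>L\<close>, so
  \<open>exp (- 2 * L * t) * (u t \<bullet> u t)\<close> is nonincreasing; it vanishes at \<open>s\<close>.\<close>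

lemma linear_ode_zero_solution_unique:
  fixes A :: "real \<Rightarrow> real ^ 'n ^ 'n"
  assumes cont: "continuous_on {0..} A"
    and der: "\<And>t. 0 \<le> t \<Longrightarrow> (u has_vector_derivative A t *v u t) (at t within {0..})"
    and "0 \<le> s" "s \<le> T" and "u s = 0"
  shows "u T = 0"
proof -
  have "bounded (A ` {s..T})"
    by (intro compact_imp_bounded compact_continuous_image continuous_on_subset[OF cont])
       (use \<open>0 \<le> s\<close> in auto)
  then obtain C where "\<forall>B\<in>A ` {s..T}. norm B \<le> C"
    unfolding bounded_iff by blast
  then have C: "norm (A t) \<le> C" if "t \<in> {s..T}" for t
    using that by blast
  define L where "L = real CARD('n) * real CARD('n) * C"
  have growth: "norm (A t *v v) \<le> L * norm v" if "t \<in> {s..T}" for t v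
  proof -
    have "\<bar>A t $ i $ j\<bar> \<le> C" for i j
      using C[OF that] Finite_Cartesian_Product.norm_nth_le[of "A t" i]
        component_le_norm_cart[of "A t $ i" j] by linarith
    then have "onorm ((*v) (A t)) \<le> L"
      unfolding L_def by (rule onorm_le_matrix_component)
    then show ?thesis
      using onorm[OF matrix_vector_mul_bounded_linear, of "A t" v]
        mult_right_mono[of "onorm ((*v) (A t))" L "norm v"] by simp
  qed
  define g where "g t = exp (- 2 * L * t) * (u t \<bullet> u t)" for t
  define g' where
    "g' t = exp (- 2 * L * t) * (2 * (u t \<bullet> (A t *v u t) - L * (u t \<bullet> u t)))" for t
  have g': "(g has_derivative (\<lambda>h. h * g' t)) (at t within {s..T})" if "s \<le> t" "t \<le> T" for t
  proof -
    have "(u has_derivative (\<lambda>h. h *\<^sub>R (A t *v u t))) (at t within {s..T})"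
      using has_vector_derivative_within_subset[OF der[of t], of "{s..T}"] that \<open>0 \<le> s\<close>
      by (auto simp: has_vector_derivative_def)
    then have "((\<lambda>t. u t \<bullet> u t) has_real_derivative 2 * (u t \<bullet> (A t *v u t)))
        (at t within {s..T})"
      unfolding has_field_derivative_def
      by (auto intro!: derivative_eq_intros simp: fun_eq_iff inner_commute algebra_simps)
    then have "(g has_real_derivative g' t) (at t within {s..T})"
      unfolding g_def g'_def by (auto intro!: derivative_eq_intros simp: algebra_simps)
    then show ?thesis by (simp add: has_field_derivative_def mult_commute_abs)
  qed
  obtain t where t: "t \<in> {s..T}" and mvt: "g T - g s = (T - s) * g' t"
    using mvt_very_simple[OF \<open>s \<le> T\<close> g'] by blast
  have "u t \<bullet> (A t *v u t) \<le> norm (u t) * norm (A t *v u t)"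
    by (rule norm_cauchy_schwarz)
  also have "\<dots> \<le> norm (u t) * (L * norm (u t))"
    using growth[OF t] by (intro mult_left_mono) auto
  finally have "g' t \<le> 0"
    unfolding g'_def by (auto intro!: mult_nonneg_nonpos simp: dot_square_norm power2_eq_square mult_ac)
  then have "g T \<le> g s"
    using mvt \<open>s \<le> T\<close> mult_nonneg_nonpos[of "T - s" "g' t"] by simp
  then show ?thesis using \<open>u s = 0\<close> by (simp add: g_def mult_le_0_iff dot_square_norm)
qed

lemma transition_matrix_apply_has_vector_derivative:
  assumes "is_transition_matrix A \<Phi>" "0 \<le> s" "0 \<le> t"
  shows "((\<lambda>t. \<Phi> t s *v v) has_vector_derivative A t *v (\<Phi> t s *v v)) (at t within {0..})"
proof -
  have "linear (\<lambda>B. B *v v :: real ^ 'n)"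
    by (rule linearI) (simp_all add: matrix_vector_mult_add_rdistrib scaleR_matrix_vector_assoc)
  then have "bounded_linear (\<lambda>B. B *v v :: real ^ 'n)"
    by (simp add: linear_conv_bounded_linear)
  moreover have "((\<lambda>t. \<Phi> t s) has_vector_derivative A t ** \<Phi> t s) (at t within {0..})"
    using assms unfolding is_transition_matrix_def by blast
  ultimately show ?thesis
    using bounded_linear.has_vector_derivative by (fastforce simp: matrix_vector_mul_assoc)
qed

text \<open>As functions of \<open>t\<close>, both sides solve the linear equation and agree at \<open>t = s\<close>.\<close>

lemma transition_matrix_cocycle:
  fixes A :: "real \<Rightarrow> real ^ 'n ^ 'n"
  assumes cont: "continuous_on {0..} A" and tm: "is_transition_matrix A \<Phi>"
    and "0 \<le> r" "r \<le> s" "s \<le> t"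
  shows "\<Phi> t r *v v = \<Phi> t s *v (\<Phi> s r *v v)"
proof -
  have "0 \<le> s" using assms by simp
  define u where "u t = \<Phi> t r *v v - \<Phi> t s *v (\<Phi> s r *v v)" for t
  have "(u has_vector_derivative A t *v u t) (at t within {0..})" if "0 \<le> t" for t
    unfolding u_def matrix_vector_mult_diff_distrib
    by (intro has_vector_derivative_diff transition_matrix_apply_has_vector_derivative[OF tm])
       (use that \<open>0 \<le> r\<close> \<open>0 \<le> s\<close> in auto)
  moreover have "u s = 0"
    using tm \<open>0 \<le> s\<close> unfolding u_def is_transition_matrix_def by simp
  ultimately have "u t = 0"
    using linear_ode_zero_solution_unique[OF cont] \<open>0 \<le> s\<close> \<open>s \<le> t\<close> by blast
  then show ?thesis by (simp add: u_def)
qed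

section \<open>Slowly moved vectors under an exponentially stable flow\<close>

text \<open>The bounds concern the action of the matrices on vectors, so that the argument runs with one
  vector norm; a compatible matrix norm enters only when the locale is instantiated.\<close>

locale exponentially_stable_system =
  fixes N :: "real ^ 'n \<Rightarrow> real"
    and A :: "real \<Rightarrow> real ^ 'n ^ 'n"
    and \<Phi> :: "real \<Rightarrow> real \<Rightarrow> real ^ 'n ^ 'n"
    and M K \<alpha> :: real
  assumes N: "is_norm N"
    and cont: "continuous_on {0..} A"
    and tm: "is_transition_matrix A \<Phi>"
    and M_nonneg: "0 \<le> M" and K_nonneg: "0 \<le> K" and \<alpha>_pos: "0 < \<alpha>"
    and A_bound: "\<And>t v. 0 \<le> t \<Longrightarrow> N (A t *v v) \<le> M * N v"
    and \<Phi>_bound: "\<And>t s v. 0 \<le> s \<Longrightarrow> s \<le> t \<Longrightarrow> N (\<Phi> t s *v v) \<le> K * exp (- \<alpha> * (t - s)) * N v"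
begin

lemma N_nonneg: "0 \<le> N v"
  using N unfolding is_norm_def by blast

lemma \<Phi>_refl: "0 \<le> s \<Longrightarrow> \<Phi> s s *v v = v"
  using tm unfolding is_transition_matrix_def by simp

lemma displacement_le:
  assumes "0 \<le> s" "s \<le> t"
    and "\<And>r. r \<in> {s..t} \<Longrightarrow> N (A r *v (\<Phi> r s *v v)) \<le> B"
  shows "N (\<Phi> t s *v v - v) \<le> (t - s) * B"
proof -
  have "N (\<Phi> t s *v v - \<Phi> s s *v v) \<le> (t - s) * B"
  proof (rule is_norm_mean_value_inequality[OF N \<open>s \<le> t\<close>])
    fix r assume r: "r \<in> {s..t}"
    show "((\<lambda>r. \<Phi> r s *v v) has_vector_derivative A r *v (\<Phi> r s *v v)) (at r within {s..t})"
      by (rule has_vector_derivative_within_subset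
          [OF transition_matrix_apply_has_vector_derivative[OF tm]])
         (use r \<open>0 \<le> s\<close> in auto)
  qed (rule assms(3))
  then show ?thesis by (simp add: \<Phi>_refl \<open>0 \<le> s\<close>)
qed

text \<open>Over a short time the velocity \<open>A r *v (\<Phi> r s *v z)\<close> differs from \<open>A r *v z\<close> only by \<open>O(h)\<close>,
  because \<open>\<Phi> r s *v z\<close> itself is within \<open>O(h)\<close> of \<open>z\<close>.  What matters is that the bound is uniform
  in the starting time \<open>s\<close>.\<close>

lemma one_step_displacement:
  assumes slow: "\<And>t. 0 \<le> t \<Longrightarrow> N (A t *v z) \<le> \<gamma> * N z"
    and "0 \<le> s" "0 \<le> h"
  shows "N (\<Phi> (s + h) s *v z - z) \<le> h * ((\<gamma> + M\<^sup>2 * K * h) * N z)"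
proof -
  \<comment> \<open>The a priori bound \<open>N (A p *v (\<Phi> p s *v z)) \<le> M * K * N z\<close> on the velocity suffices here; it is
    inserted below to get the sharp first-order constant \<open>\<gamma>\<close>.\<close>
  have crude: "N (\<Phi> r s *v z - z) \<le> h * (M * K * N z)" if r: "r \<in> {s..s + h}" for r
  proof -
    have "N (\<Phi> r s *v z - z) \<le> (r - s) * (M * K * N z)"
    proof (rule displacement_le)
      fix p assume p: "p \<in> {s..r}"
      have "N (A p *v (\<Phi> p s *v z)) \<le> M * N (\<Phi> p s *v z)"
        using A_bound p \<open>0 \<le> s\<close> by simp
      also have "\<dots> \<le> M * (K * exp (- \<alpha> * (p - s)) * N z)"
        using \<Phi>_bound[of s p z] p \<open>0 \<le> s\<close> M_nonneg by (intro mult_left_mono) auto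
      also have "\<dots> \<le> M * (K * 1 * N z)"
        using p M_nonneg K_nonneg \<alpha>_pos N_nonneg
        by (intro mult_left_mono mult_right_mono) auto
      finally show "N (A p *v (\<Phi> p s *v z)) \<le> M * K * N z" by simp
    qed (use r \<open>0 \<le> s\<close> in auto)
    also have "\<dots> \<le> h * (M * K * N z)"
      using r M_nonneg K_nonneg N_nonneg by (intro mult_right_mono) auto
    finally show ?thesis .
  qed
  have "N (\<Phi> (s + h) s *v z - z) \<le> (s + h - s) * ((\<gamma> + M\<^sup>2 * K * h) * N z)"
  proof (rule displacement_le)
    fix r assume r: "r \<in> {s..s + h}"
    then have "0 \<le> r" using \<open>0 \<le> s\<close> by simp
    have "A r *v (\<Phi> r s *v z) = A r *v z + A r *v (\<Phi> r s *v z - z)"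
      by (simp add: matrix_vector_mult_diff_distrib)
    then have "N (A r *v (\<Phi> r s *v z)) \<le> N (A r *v z) + N (A r *v (\<Phi> r s *v z - z))"
      using is_norm_triangle[OF N] by metis
    also have "\<dots> \<le> \<gamma> * N z + M * (h * (M * K * N z))"
      using slow[OF \<open>0 \<le> r\<close>] A_bound[OF \<open>0 \<le> r\<close>, of "\<Phi> r s *v z - z"]
        mult_left_mono[OF crude[OF r] M_nonneg] by linarith
    finally show "N (A r *v (\<Phi> r s *v z)) \<le> (\<gamma> + M\<^sup>2 * K * h) * N z"
      by (simp add: power2_eq_square algebra_simps)
  qed (use \<open>0 \<le> s\<close> \<open>0 \<le> h\<close> in auto)
  then show ?thesis by simp
qed

text \<open>The first of \<open>Suc n\<close> steps displaces \<open>z\<close> by at most \<open>d\<close>; that error is then damped by the flow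
  over the remaining \<open>n\<close> steps.  The remaining displacement is the claim for \<open>n\<close> with a later
  starting time, which is why \<open>s\<close> must vary in the induction.\<close>

lemma displacement_le_geometric_sum:
  assumes "0 \<le> h" and step: "\<And>s. 0 \<le> s \<Longrightarrow> N (\<Phi> (s + h) s *v z - z) \<le> d"
    and "0 \<le> s"
  shows "N (\<Phi> (s + real n * h) s *v z - z) \<le> K * d * (\<Sum>j<n. exp (- \<alpha> * h) ^ j)"
  using \<open>0 \<le> s\<close>
proof (induction n arbitrary: s)
  case 0
  then show ?case by (simp add: \<Phi>_refl is_norm_zero[OF N])
next
  case (Suc n)
  let ?t = "s + real (Suc n) * h"
  have t: "?t = s + h + real n * h" by (simp add: algebra_simps)
  have sh: "0 \<le> s + h" "s \<le> s + h" "s + h \<le> ?t"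
    using Suc.prems \<open>0 \<le> h\<close> by (auto simp: algebra_simps)
  have "\<Phi> ?t s *v z - z =
      \<Phi> ?t (s + h) *v (\<Phi> (s + h) s *v z - z) + (\<Phi> ?t (s + h) *v z - z)"
    using transition_matrix_cocycle[OF cont tm Suc.prems sh(2,3)]
    by (simp add: matrix_vector_mult_diff_distrib)
  then have "N (\<Phi> ?t s *v z - z) \<le>
      N (\<Phi> ?t (s + h) *v (\<Phi> (s + h) s *v z - z)) + N (\<Phi> ?t (s + h) *v z - z)"
    using is_norm_triangle[OF N] by metis
  also have "N (\<Phi> ?t (s + h) *v (\<Phi> (s + h) s *v z - z)) \<le> K * exp (- \<alpha> * h) ^ n * d"
  proof -
    have "N (\<Phi> ?t (s + h) *v (\<Phi> (s + h) s *v z - z))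
        \<le> K * exp (- \<alpha> * (?t - (s + h))) * N (\<Phi> (s + h) s *v z - z)"
      by (rule \<Phi>_bound[OF sh(1,3)])
    also have "\<dots> \<le> K * exp (- \<alpha> * (?t - (s + h))) * d"
      using step[OF Suc.prems] K_nonneg by (intro mult_left_mono) auto
    also have "exp (- \<alpha> * (?t - (s + h))) = exp (- \<alpha> * h) ^ n"
      by (simp add: t exp_of_nat_mult[symmetric] algebra_simps)
    finally show ?thesis .
  qed
  also have "N (\<Phi> ?t (s + h) *v z - z) \<le> K * d * (\<Sum>j<n. exp (- \<alpha> * h) ^ j)"
    using Suc.IH[OF sh(1)] unfolding t .
  finally show ?case by (simp add: algebra_simps)
qed

text \<open>The limit \<open>n \<rightarrow> \<infinity>\<close> at fixed step \<open>h\<close>: after \<open>n\<close> steps \<open>z\<close> is carried to something of norm at most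
  \<open>K * exp (- \<alpha> * h) ^ n * N z\<close>, so in the limit the total displacement has norm \<open>N z\<close>.\<close>

lemma slow_vector_norm_le:
  assumes slow: "\<And>t. 0 \<le> t \<Longrightarrow> N (A t *v z) \<le> \<gamma> * N z" and "0 < h"
  shows "N z \<le> K * (h * ((\<gamma> + M\<^sup>2 * K * h) * N z)) * (1 / (1 - exp (- \<alpha> * h)))"
proof -
  define d where "d = h * ((\<gamma> + M\<^sup>2 * K * h) * N z)"
  define q where "q = exp (- \<alpha> * h)"
  have q: "0 < q" "q < 1" using \<alpha>_pos \<open>0 < h\<close> by (auto simp: q_def)
  have "N z \<le> K * q ^ n * N z + K * d * (\<Sum>j<n. q ^ j)" for n
  proof -
    let ?w = "\<Phi> (real n * h) 0 *v z"
    have "z = ?w + (z - ?w)" by simp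
    then have "N z \<le> N ?w + N (z - ?w)" using is_norm_triangle[OF N] by metis
    moreover have "N ?w \<le> K * q ^ n * N z"
      using \<Phi>_bound[of 0 "real n * h" z] \<open>0 < h\<close>
      by (simp add: q_def exp_of_nat_mult[symmetric] algebra_simps)
    moreover have "N (z - ?w) \<le> K * d * (\<Sum>j<n. q ^ j)"
      using displacement_le_geometric_sum[of h z d 0 n] one_step_displacement[OF slow] \<open>0 < h\<close>
      by (simp add: d_def q_def is_norm_minus_commute[OF N, of z])
    ultimately show ?thesis by linarith
  qed
  moreover have "(\<lambda>n. K * q ^ n * N z + K * d * (\<Sum>j<n. q ^ j))
      \<longlonglongrightarrow> K * 0 * N z + K * d * (1 / (1 - q))"
    using q geometric_sums[of q] unfolding sums_def
    by (intro tendsto_intros LIMSEQ_realpow_zero) auto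
  ultimately have "N z \<le> K * 0 * N z + K * d * (1 / (1 - q))"
    by (intro LIMSEQ_le_const) auto
  then show ?thesis by (simp add: d_def q_def)
qed

text \<open>As \<open>h\<close> tends to \<open>0\<close> from the right, \<open>h / (1 - exp (- \<alpha> * h))\<close> tends to \<open>1 / \<alpha>\<close> and the
  quadratic error of a single step disappears.\<close>

lemma slow_vector_eq_0:
  assumes slow: "\<And>t. 0 \<le> t \<Longrightarrow> N (A t *v z) \<le> \<gamma> * N z" and "K * \<gamma> < \<alpha>"
  shows "z = 0"
proof -
  have "((\<lambda>h. K * (h * ((\<gamma> + M\<^sup>2 * K * h) * N z)) * (1 / (1 - exp (- \<alpha> * h))))
      \<longlongrightarrow> K * \<gamma> * N z / \<alpha>) (at_right 0)"
  proof -
    have "((\<lambda>h. h / (1 - exp (- \<alpha> * h))) \<longlongrightarrow> inverse \<alpha>) (at_right 0)"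
      using \<alpha>_pos by real_asymp
    then have "((\<lambda>h. K * ((\<gamma> + M\<^sup>2 * K * h) * N z) * (h / (1 - exp (- \<alpha> * h))))
        \<longlongrightarrow> K * ((\<gamma> + M\<^sup>2 * K * 0) * N z) * inverse \<alpha>) (at_right 0)"
      by (intro tendsto_intros)
    then show ?thesis by (simp add: mult_ac divide_inverse)
  qed
  moreover have "\<forall>\<^sub>F h in at_right 0.
      N z \<le> K * (h * ((\<gamma> + M\<^sup>2 * K * h) * N z)) * (1 / (1 - exp (- \<alpha> * h)))"
    using slow_vector_norm_le[OF slow] by (auto intro: eventually_at_rightI[of 0 1])
  ultimately have "N z \<le> K * \<gamma> * N z / \<alpha>"
    by (intro tendsto_lowerbound) auto
  then have "(\<alpha> - K * \<gamma>) * N z \<le> 0"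
    using \<alpha>_pos by (simp add: field_simps)
  then have "N z = 0"
    using \<open>K * \<gamma> < \<alpha>\<close> N_nonneg[of z] by (simp add: mult_le_0_iff)
  then show ?thesis using N unfolding is_norm_def by blast
qed

end

section \<open>Uniqueness of the equilibrium\<close>

theorem lemma1:
  fixes A :: "real \<Rightarrow> real ^ 'n ^ 'n"
    and \<Phi> :: "real \<Rightarrow> real \<Rightarrow> real ^ 'n ^ 'n"
    and f :: "real \<Rightarrow> real ^ 'n \<Rightarrow> real ^ 'n"
    and vnorm :: "real ^ 'n \<Rightarrow> real"
    and mnorm :: "real ^ 'n ^ 'n \<Rightarrow> real"
    and M K \<alpha> \<gamma> \<mu> :: real
  assumes "is_norm vnorm" and "is_norm mnorm" and "compatible_norms vnorm mnorm"
    and "continuous_on {0..} A"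
    and "bdd_above ((\<lambda>t. mnorm (A t)) ` {0..})"
    and "(SUP t\<in>{0..}. mnorm (A t)) = M" and "M > 0"
    and "is_transition_matrix A \<Phi>"
    and "K \<ge> 1" and "\<alpha> > 0"
    and "\<And>t s. 0 \<le> s \<Longrightarrow> s \<le> t \<Longrightarrow> mnorm (\<Phi> t s) \<le> K * exp (- \<alpha> * (t - s))"
    and "\<gamma> \<ge> 0" and "\<mu> \<ge> 0"
    and "\<And>t y y'. 0 \<le> t \<Longrightarrow> vnorm (f t y - f t y') \<le> \<gamma> * vnorm (y - y')"
    and "\<And>t y. 0 \<le> t \<Longrightarrow> vnorm (f t y) \<le> \<mu>"
    and "K * \<gamma> / \<alpha> < 1"
    and "\<exists>y. is_equilibrium A f y"
  shows "\<exists>!y. is_equilibrium A f y"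
proof (rule ex_ex1I)
  fix y1 y2
  assume eq: "is_equilibrium A f y1" "is_equilibrium A f y2"
  note compatible = \<open>compatible_norms vnorm mnorm\<close>[unfolded compatible_norms_def, rule_format]
  have vnorm_nonneg: "0 \<le> vnorm v" for v
    using \<open>is_norm vnorm\<close> unfolding is_norm_def by blast
  have "mnorm (A t) \<le> M" if "0 \<le> t" for t
    using cSUP_upper[of t "{0..}" "\<lambda>t. mnorm (A t)"] assms(5,6) that by simp
  then have A_bound: "vnorm (A t *v v) \<le> M * vnorm v" if "0 \<le> t" for t v
    using compatible[of "A t" v] that vnorm_nonneg by (meson mult_right_mono order_trans)
  have \<Phi>_bound: "vnorm (\<Phi> t s *v v) \<le> K * exp (- \<alpha> * (t - s)) * vnorm v"
    if "0 \<le> s" "s \<le> t" for t s v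
    using compatible[of "\<Phi> t s" v] assms(11)[OF that] vnorm_nonneg
    by (meson mult_right_mono order_trans)
  interpret exponentially_stable_system vnorm A \<Phi> M K \<alpha>
    by unfold_locales (use assms A_bound \<Phi>_bound in auto)
  have "y2 - y1 = 0"
  proof (rule slow_vector_eq_0)
    fix t :: real assume "0 \<le> t"
    then have "A t *v y1 + f t y1 = 0" "A t *v y2 + f t y2 = 0"
      using eq unfolding is_equilibrium_def by auto
    then have "A t *v (y2 - y1) = f t y1 - f t y2"
      by (simp add: matrix_vector_mult_diff_distrib add_eq_0_iff)
    then show "vnorm (A t *v (y2 - y1)) \<le> \<gamma> * vnorm (y2 - y1)"
      using assms(14)[OF \<open>0 \<le> t\<close>, of y1 y2] is_norm_minus_commute[OF \<open>is_norm vnorm\<close>, of y1 y2]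
      by simp
  next
    show "K * \<gamma> < \<alpha>" using \<open>K * \<gamma> / \<alpha> < 1\<close> \<open>\<alpha> > 0\<close> by (simp add: field_simps)
  qed
  then show "y1 = y2" by simp
qed (rule \<open>\<exists>y. is_equilibrium A f y\<close>)

end
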